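(* Let $c>0$, let $v\in\mathbb{R}$ with $|v|<c$, and put $\beta=v/c$ and $\gamma(v)=1/\sqrt{1-\beta^2}$. Let $W=(W^0,W^1,W^2,W^3)$ be a smooth invertible (with smooth inverse) nonlinear coordinate transformation $W:F\to F_I$, $x_I^\nu=W^\nu(x^0,x^1,x^2,x^3)$, from an open set $F\subset\mathbb{R}^4$ with coordinates $x^\nu$ onto an open set of Minkowski space $M^4$ with inertial coordinates $x_I^\nu$ (where $x_I^0=ct_I$). Let $L^v:\mathbb{R}^4\to\mathbb{R}^4$ be the Lorentz boost $$(L^v)^0(x)=\gamma(v)(x^0+\beta x^1),\quad (L^v)^1(x)=\gamma(v)(x^1+\beta x^0),\quad (L^v)^2(x)=x^2,\quad (L^v)^3(x)=x^3,$$ and define $W_{L^v}(x)=L^v[W(x)]$. Let $ds_W^2$ be the metric formed by $W$ and let $ds_W^2[v]$ be the metric formed by $W_{L^v}$. Then $$ds_W^2=ds_W^2[v],$$ and $$\left[ds_W^2\right]_{x=W_{L^v}^{-1}(x_I)}=c^2dt_I^2-(dx_I^1)^2-(dx_I^2)^2-(dx_I^3)^2,$$ where the subscript denotes the substitution $x^\nu=(W_{L^v}^{-1})^\nu(x_I)$, $\nu=0,1,2,3$ (i.e. pullback of the metric under $W_{L^v}^{-1}$).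
   Context: Let $\eta=\mathrm{diag}(1,-1,-1,-1)$ be the Minkowski metric. For a smooth coordinate transformation $x_I^\nu=W^\nu(x)$ from $F$ to Minkowski space, the metric $ds_W^2=g_{\mu\nu}(x)\,dx^\mu dx^\nu$ is said to be formed by $W$ if $$g_{\mu\nu}(x)=\sum_{\alpha,\beta=0}^{3}\eta_{\alpha\beta}\frac{\partial W^\alpha(x)}{\partial x^\mu}\frac{\partial W^\beta(x)}{\partial x^\nu},\qquad \mu,\nu=0,1,2,3,$$ i.e. if it is the pullback of the Minkowski metric by $W$. *)

theory Defs
  imports "HOL-Analysis.Analysis"
begin

text \<open>
  Points of four-dimensional space have type \<^typ>\<open>real ^ 4\<close>. The index type 4 consists of the
  residues 0, 1, 2, 3, so \<open>x $ 0\<close>, ..., \<open>x $ 3\<close> are the coordinates as usually numbered in relativity.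
\<close>

section \<open>Smooth maps\<close>

text \<open>
  On an open set of a Euclidean space, being \<open>k\<close> times continuously differentiable is the same as
  having all iterated directional derivatives up to order \<open>k\<close>, each differentiable below
  order \<open>k\<close> and continuous at order \<open>k\<close>.
\<close>

primrec Ck_on :: "nat \<Rightarrow> 'a::euclidean_space set \<Rightarrow> ('a \<Rightarrow> 'b::real_normed_vector) \<Rightarrow> bool" where
  "Ck_on 0 S f \<longleftrightarrow> continuous_on S f"
| "Ck_on (Suc k) S f \<longleftrightarrow>
     (\<forall>x\<in>S. f differentiable (at x)) \<and> (\<forall>u. Ck_on k S (\<lambda>x. frechet_derivative f (at x) u))"

definition smooth_on :: "'a::euclidean_space set \<Rightarrow> ('a \<Rightarrow> 'b::real_normed_vector) \<Rightarrow> bool" where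
  "smooth_on S f \<longleftrightarrow> (\<forall>k. Ck_on k S f)"

definition smooth_transformation ::
    "(real ^ 4 \<Rightarrow> real ^ 4) \<Rightarrow> (real ^ 4) set \<Rightarrow> (real ^ 4) set \<Rightarrow> bool" where
  "smooth_transformation W F F\<^sub>I \<longleftrightarrow>
     open F \<and> open F\<^sub>I \<and> bij_betw W F F\<^sub>I \<and> smooth_on F W \<and> smooth_on F\<^sub>I (inv_into F W)"

section \<open>Metrics formed by coordinate transformations\<close>

definition minkowski :: "real ^ 4 ^ 4" where
  "minkowski = (\<chi> \<alpha> \<beta>. if \<alpha> \<noteq> \<beta> then 0 else if \<alpha> = 0 then 1 else -1)"

definition partial :: "4 \<Rightarrow> (real ^ 4 \<Rightarrow> real) \<Rightarrow> real ^ 4 \<Rightarrow> real" where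
  "partial \<mu> f x = deriv (\<lambda>h. f (x + h *\<^sub>R axis \<mu> 1)) 0"

definition metric_coeff :: "(real ^ 4 \<Rightarrow> real ^ 4) \<Rightarrow> real ^ 4 \<Rightarrow> real ^ 4 ^ 4" where
  "metric_coeff W x = (\<chi> \<mu> \<nu>. \<Sum>\<alpha>\<in>UNIV. \<Sum>\<beta>\<in>UNIV.
     minkowski $ \<alpha> $ \<beta> * partial \<mu> (\<lambda>y. W y $ \<alpha>) x * partial \<nu> (\<lambda>y. W y $ \<beta>) x)"

text \<open>
  A metric \<open>ds\<^sup>2\<close> is represented as the field of quadratic forms that assigns to a point \<open>x\<close> and
  a tangent vector at \<open>x\<close> with components \<open>dx\<^sup>\<mu>\<close> the value \<open>g\<^sub>\<mu>\<^sub>\<nu>(x) dx\<^sup>\<mu> dx\<^sup>\<nu>\<close>.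
\<close>

definition formed_metric :: "(real ^ 4 \<Rightarrow> real ^ 4) \<Rightarrow> real ^ 4 \<Rightarrow> real ^ 4 \<Rightarrow> real" where
  "formed_metric W x dx = (\<Sum>\<mu>\<in>UNIV. \<Sum>\<nu>\<in>UNIV. metric_coeff W x $ \<mu> $ \<nu> * dx $ \<mu> * dx $ \<nu>)"

text \<open>
  The substitution \<open>x = \<phi>(y)\<close> in a metric also replaces \<open>dx\<close> by the differential
  of \<open>\<phi>\<close> at \<open>y\<close> applied to \<open>dy\<close>.
\<close>

definition substitute_metric ::
    "(real ^ 4 \<Rightarrow> real ^ 4) \<Rightarrow> (real ^ 4 \<Rightarrow> real ^ 4 \<Rightarrow> real) \<Rightarrow> real ^ 4 \<Rightarrow> real ^ 4 \<Rightarrow> real" where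
  "substitute_metric \<phi> G y dy = G (\<phi> y) (frechet_derivative \<phi> (at y) dy)"

section \<open>Lorentz boosts\<close>

definition lorentz_gamma :: "real \<Rightarrow> real \<Rightarrow> real" where
  "lorentz_gamma c v = 1 / sqrt (1 - (v / c)\<^sup>2)"

definition lorentz_boost :: "real \<Rightarrow> real \<Rightarrow> real ^ 4 \<Rightarrow> real ^ 4" where
  "lorentz_boost c v x = (\<chi> i.
     if i = 0 then lorentz_gamma c v * (x $ 0 + v / c * x $ 1)
     else if i = 1 then lorentz_gamma c v * (x $ 1 + v / c * x $ 0)
     else x $ i)"

end

theory Submission
  imports Defs
begin

text \<open>
  By the chain rule, the metric formed by \<open>W\<close> is the Minkowski quadratic form evaluated at the
  Frechet derivative of \<open>W\<close>. A Lorentz boost preserves this form, so boosting \<open>W\<close> does not change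
  the metric. Differentiating \<open>W\<^sub>L (W\<^sub>L\<^sup>-\<^sup>1 y) = y\<close> shows that substituting the inverse of the boosted
  transformation leaves the Minkowski form itself.
\<close>

lemma smooth_on_imp_differentiable:
  assumes "smooth_on S f" "x \<in> S"
  shows "f differentiable (at x)"
proof -
  have "Ck_on (Suc 0) S f"
    using assms(1) by (simp only: smooth_on_def)
  then show ?thesis
    using assms(2) by simp
qed

definition minkowski_form :: "real ^ 4 \<Rightarrow> real" where
  "minkowski_form u = (u $ 0)\<^sup>2 - (u $ 1)\<^sup>2 - (u $ 2)\<^sup>2 - (u $ 3)\<^sup>2"

lemma sum_UNIV_4: "(\<Sum>i\<in>UNIV. f i) = f 0 + f 1 + f 2 + f (3::4)"
proof -
  \<comment> \<open>The index type consists of residues mod 4, so the summand at index 4 in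
    \<open>sum_4\<close> is the time component.\<close>
  have "(4::4) = 0" by simp
  then show ?thesis
    by (simp only: sum_4) (simp add: ac_simps)
qed

lemma minkowski_sum:
  "(\<Sum>\<alpha>\<in>UNIV. \<Sum>\<beta>\<in>UNIV. minkowski $ \<alpha> $ \<beta> * a \<alpha> * b \<beta>) =
    a 0 * b 0 - a 1 * b 1 - a 2 * b 2 - a 3 * b 3"
  by (simp add: sum_UNIV_4 minkowski_def)

text \<open>Chain rule along the coordinate line through \<open>x\<close> in direction
  \<open>axis \<mu> 1\<close>; linearity of \<open>D\<close> turns the derivative in
  \<open>h\<close> into multiplication by a constant.\<close>

lemma partial_component:
  assumes "(W has_derivative D) (at x)"
  shows "partial \<mu> (\<lambda>y. W y $ \<alpha>) x = D (axis \<mu> 1) $ \<alpha>"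
proof -
  have line: "((\<lambda>h. x + h *\<^sub>R axis \<mu> 1) has_derivative (\<lambda>h. h *\<^sub>R axis \<mu> 1)) (at 0)"
    by (auto intro!: derivative_eq_intros)
  have "((\<lambda>h. W (x + h *\<^sub>R axis \<mu> 1)) has_derivative (\<lambda>h. D (h *\<^sub>R axis \<mu> 1))) (at 0)"
    using has_derivative_compose[OF line] assms by simp
  then have "((\<lambda>h. W (x + h *\<^sub>R axis \<mu> 1) $ \<alpha>) has_derivative (\<lambda>h. D (h *\<^sub>R axis \<mu> 1) $ \<alpha>)) (at 0)"
    by (rule bounded_linear.has_derivative[OF bounded_linear_vec_nth])
  moreover have "(\<lambda>h. D (h *\<^sub>R axis \<mu> 1) $ \<alpha>) = (*) (D (axis \<mu> 1) $ \<alpha>)"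
    using has_derivative_linear[OF assms] by (auto simp: linear_cmul)
  ultimately show ?thesis
    unfolding partial_def by (intro DERIV_imp_deriv) (simp add: has_field_derivative_def)
qed

text \<open>Expanding \<open>u\<close> in the standard basis writes each component of
  \<open>D u\<close> as a sum over \<open>\<mu>\<close>; the double sum over \<open>\<mu>\<close>
  and \<open>\<nu>\<close> then factors into squares of these components.\<close>

lemma formed_metric_eq:
  assumes "(W has_derivative D) (at x)"
  shows "formed_metric W x u = minkowski_form (D u)"
proof -
  define d where "d \<alpha> \<mu> = D (axis \<mu> 1) $ \<alpha> * u $ \<mu>" for \<alpha> \<mu>
  have D: "D u $ \<alpha> = (\<Sum>\<mu>\<in>UNIV. d \<alpha> \<mu>)" for \<alpha>
    using linear_componentwise[of D u \<alpha>] has_derivative_linear[OF assms]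
    by (simp add: d_def mult.commute linear_matrix_vector_mul_eq)
  have "formed_metric W x u = (\<Sum>\<mu>\<in>UNIV. \<Sum>\<nu>\<in>UNIV.
      d 0 \<mu> * d 0 \<nu> - d 1 \<mu> * d 1 \<nu> - d 2 \<mu> * d 2 \<nu> - d 3 \<mu> * d 3 \<nu>)"
    unfolding formed_metric_def metric_coeff_def partial_component[OF assms] minkowski_sum
    by (intro sum.cong) (simp_all add: d_def algebra_simps)
  also have "\<dots> = minkowski_form (D u)"
    by (simp add: minkowski_form_def D power2_eq_square sum_product sum_subtractf)
  finally show ?thesis .
qed

lemma linear_lorentz_boost: "linear (lorentz_boost c v)"
  by (rule linearI) (auto simp: lorentz_boost_def vec_eq_iff algebra_simps)

lemma has_derivative_lorentz_boost:
  "(f has_derivative D) F \<Longrightarrow>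
    ((\<lambda>x. lorentz_boost c v (f x)) has_derivative (\<lambda>u. lorentz_boost c v (D u))) F"
  by (rule bounded_linear.has_derivative[OF linear_conv_bounded_linear[THEN iffD1, OF linear_lorentz_boost]])

text \<open>The bound on \<open>v\<close> makes the radicand positive. The division-free form serves
  as a polynomial hypothesis for \<open>algebra\<close>.\<close>

lemma lorentz_gamma_square:
  assumes "\<bar>v\<bar> < c"
  shows "(lorentz_gamma c v)\<^sup>2 * (1 - (v / c)\<^sup>2) = 1"
proof -
  have "\<bar>v / c\<bar> < 1"
    using assms by (simp add: abs_divide)
  then have "(v / c)\<^sup>2 < 1"
    by (simp add: abs_square_less_1)
  then show ?thesis
    by (simp add: lorentz_gamma_def power_one_over real_sqrt_pow2 del: power_divide)
qed

lemma minkowski_form_lorentz_boost: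
  assumes "\<bar>v\<bar> < c"
  shows "minkowski_form (lorentz_boost c v u) = minkowski_form u"
proof -
  define g b where "g = lorentz_gamma c v" and "b = v / c"
  have "g\<^sup>2 * (1 - b\<^sup>2) = 1"
    using lorentz_gamma_square[OF assms] by (simp add: g_def b_def)
  \<comment> \<open>The cross terms cancel, leaving the factor
    \<open>g\<^sup>2 * (1 - b\<^sup>2)\<close>.\<close>
  then have "(g * (u $ 0 + b * u $ 1))\<^sup>2 - (g * (u $ 1 + b * u $ 0))\<^sup>2 = (u $ 0)\<^sup>2 - (u $ 1)\<^sup>2"
    by algebra
  then show ?thesis
    by (simp add: minkowski_form_def lorentz_boost_def flip: g_def b_def)
qed

lemma lorentz_boost_minus:
  assumes "\<bar>v\<bar> < c"
  shows "lorentz_boost c (- v) (lorentz_boost c v u) = u"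
proof -
  define g b where "g = lorentz_gamma c v" and "b = v / c"
  have g: "lorentz_gamma c (- v) = g"
    by (simp add: g_def lorentz_gamma_def)
  have *: "g\<^sup>2 * (1 - b\<^sup>2) = 1"
    using lorentz_gamma_square[OF assms] by (simp add: g_def b_def)
  \<comment> \<open>Used for both mixed components: \<open>p\<close>, \<open>q\<close> are the
    coordinates 0 and 1 in either order.\<close>
  have "g * (g * (p + b * q) - b * (g * (q + b * p))) = p" for p q
    using * by algebra
  then show ?thesis
    unfolding vec_eq_iff
    by (simp add: lorentz_boost_def g flip: g_def b_def)
qed

theorem theorem1p1:
  fixes c v :: real
    and F F\<^sub>I :: "(real ^ 4) set"
    and W W\<^sub>L :: "real ^ 4 \<Rightarrow> real ^ 4"
  assumes "c > 0" and "\<bar>v\<bar> < c"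
    and "smooth_transformation W F F\<^sub>I"
    and nonlinear: "\<not> (\<exists>A. linear A \<and> (\<forall>x\<in>F. W x = A x))"
  defines "W\<^sub>L \<equiv> (\<lambda>x. lorentz_boost c v (W x))"
  shows "(\<forall>x\<in>F. formed_metric W x = formed_metric W\<^sub>L x) \<and>
    (\<forall>x\<^sub>I\<in>W\<^sub>L ` F. \<forall>dx\<^sub>I dt\<^sub>I. dx\<^sub>I $ 0 = c * dt\<^sub>I \<longrightarrow>
       substitute_metric (inv_into F W\<^sub>L) (formed_metric W) x\<^sub>I dx\<^sub>I =
         c\<^sup>2 * dt\<^sub>I\<^sup>2 - (dx\<^sub>I $ 1)\<^sup>2 - (dx\<^sub>I $ 2)\<^sup>2 - (dx\<^sub>I $ 3)\<^sup>2)"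
proof -
  note boost_inv = lorentz_boost_minus[OF \<open>\<bar>v\<bar> < c\<close>]
  have "open F\<^sub>I" and bij: "bij_betw W F F\<^sub>I" and W: "smooth_on F W"
    and W_inv: "smooth_on F\<^sub>I (inv_into F W)"
    using assms(3) by (auto simp: smooth_transformation_def)
  have deriv_W: "(W has_derivative frechet_derivative W (at x)) (at x)" if "x \<in> F" for x
    using smooth_on_imp_differentiable[OF W that] by (simp add: frechet_derivative_works)
  note deriv_WL = has_derivative_lorentz_boost[OF deriv_W, of _ c v, folded W\<^sub>L_def]
  have metric: "formed_metric W x = formed_metric W\<^sub>L x" if "x \<in> F" for x
    using formed_metric_eq[OF deriv_W[OF that]] formed_metric_eq[OF deriv_WL[OF that]]
    by (simp add: fun_eq_iff minkowski_form_lorentz_boost[OF \<open>\<bar>v\<bar> < c\<close>])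
  have inj_WL: "inj_on W\<^sub>L F"
    using bij boost_inv unfolding W\<^sub>L_def bij_betw_def inj_on_def by metis
  \<comment> \<open>Describing the image of \<open>W\<^sub>L\<close> as a preimage under the inverse
    boost makes its openness a matter of continuity.\<close>
  define U where "U = lorentz_boost c (- v) -` F\<^sub>I"
  have image: "W\<^sub>L ` F = U"
  proof
    show "W\<^sub>L ` F \<subseteq> U"
      using bij boost_inv by (auto simp: W\<^sub>L_def U_def bij_betw_def)
    show "U \<subseteq> W\<^sub>L ` F"
    proof
      fix y assume "y \<in> U"
      then obtain x where "x \<in> F" "W x = lorentz_boost c (- v) y"
        using bij by (force simp: U_def bij_betw_def)
      moreover have "lorentz_boost c v (lorentz_boost c (- v) y) = y"
        using lorentz_boost_minus[of "- v" c y] \<open>\<bar>v\<bar> < c\<close> by simp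
      ultimately show "y \<in> W\<^sub>L ` F"
        by (metis W\<^sub>L_def image_eqI)
    qed
  qed
  have "open U"
    unfolding U_def
    by (intro open_vimage \<open>open F\<^sub>I\<close> linear_continuous_on
        linear_conv_bounded_linear[THEN iffD1, OF linear_lorentz_boost])
  \<comment> \<open>Off the image \<open>inv_into\<close> has no controlled value, so the equation
    is claimed on \<open>U\<close> only; as \<open>U\<close> is open, this suffices to transfer
    derivatives.\<close>
  have inv_eq: "inv_into F W\<^sub>L y = inv_into F W (lorentz_boost c (- v) y)" if y: "y \<in> U" for y
  proof -
    obtain x where "x \<in> F" "y = W\<^sub>L x"
      using image y by blast
    then show ?thesis
      using bij inj_WL boost_inv by (simp add: inv_into_f_f bij_betw_def) (simp add: W\<^sub>L_def boost_inv)
  qed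
  have "substitute_metric (inv_into F W\<^sub>L) (formed_metric W) y dy = minkowski_form dy"
    if y: "y \<in> W\<^sub>L ` F" for y dy
  proof -
    let ?G = "inv_into F W\<^sub>L" and ?x = "inv_into F W\<^sub>L y"
    have "y \<in> U" and x: "?x \<in> F"
      using image inv_into_into[OF y] y by auto
    \<comment> \<open>Differentiability of the inverse comes from the assumed smoothness on
      \<open>F\<^sub>I\<close>, not from an inverse function theorem.\<close>
    then have "inv_into F W differentiable (at (lorentz_boost c (- v) y))"
      using smooth_on_imp_differentiable[OF W_inv] by (auto simp: U_def)
    then have "(\<lambda>z. inv_into F W (lorentz_boost c (- v) z)) differentiable (at y)"
      using has_derivative_compose[OF has_derivative_lorentz_boost[OF has_derivative_ident]]
      unfolding differentiable_def by blast
    then obtain G' where "((\<lambda>z. inv_into F W (lorentz_boost c (- v) z)) has_derivative G') (at y)"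
      unfolding differentiable_def by blast
    then have G: "(?G has_derivative G') (at y)"
      using has_derivative_transform_within_open[OF _ \<open>open U\<close> \<open>y \<in> U\<close>] inv_eq by metis
    let ?D = "\<lambda>u. lorentz_boost c v (frechet_derivative W (at ?x) u)"
    have "((\<lambda>z. W\<^sub>L (?G z)) has_derivative (\<lambda>u. ?D (G' u))) (at y)"
      by (rule has_derivative_compose[OF G deriv_WL[OF x]])
    moreover have "((\<lambda>z. W\<^sub>L (?G z)) has_derivative (\<lambda>u. u)) (at y)"
      by (rule has_derivative_transform_within_open[OF has_derivative_ident \<open>open U\<close> \<open>y \<in> U\<close>])
        (simp add: f_inv_into_f image)
    \<comment> \<open>Near \<open>y\<close> the composite is the identity, so uniqueness of the
      derivative makes \<open>G'\<close> a right inverse of \<open>?D\<close>.\<close>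
    ultimately have "?D (G' dy) = dy"
      by (metis has_derivative_unique)
    moreover have "frechet_derivative ?G (at y) = G'"
      using frechet_derivative_at[OF G] by simp
    \<comment> \<open>By \<open>metric\<close>, the form of \<open>W\<close> at \<open>?x\<close>
      may be computed with \<open>W\<^sub>L\<close>, whose derivative \<open>?D\<close> cancels
      \<open>G'\<close>.\<close>
    ultimately show ?thesis
      unfolding substitute_metric_def metric[OF x] formed_metric_eq[OF deriv_WL[OF x]]
      by simp
  qed
  then show ?thesis
    using metric by (auto simp: minkowski_form_def power_mult_distrib)
qed

end
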